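(* ComplEx-NNE+AER cannot satisfy its constraints and be fully expressive if symmetry constraints are allowed. That is, there exist a finite set of entities $\mathcal E$, a finite set of relations $\mathcal R$ containing two relations $r,s$, and a set of true triples $\mathcal W\subseteq \mathcal E\times\mathcal R\times\mathcal E$ satisfying the subsumption $(h,r,t)\in\mathcal W\Rightarrow (h,s,t)\in\mathcal W$ for all $h,t\in\mathcal E$ and the symmetry $(h,r,t)\in\mathcal W\Rightarrow(t,r,h)\in\mathcal W$ for all $h,t\in\mathcal E$, such that for no $k\ge1$ do there exist legal entity embeddings for the elements of $\mathcal E$ and relation embeddings in $\mathbb C^k$ for the elements of $\mathcal R$ for which simultaneously: (i) the subsumption constraints of ComplEx-NNE+AER hold for $r\rightarrow s$; (ii) the symmetry constraint for $r$ holds, i.e. $\mu(\mathbf h,\mathbf r,\mathbf t)=\mu(\mathbf t,\mathbf r,\mathbf h)$ for all legal entity embeddings $\mathbf h,\mathbf t$; and (iii) the embeddings represent $\mathcal W$.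
   Context: For vectors $\mathbf x,\mathbf y,\mathbf z$ of length $k$, write $\langle \mathbf x,\mathbf y,\mathbf z\rangle=\sum_{\ell=1}^k x_\ell y_\ell z_\ell$. In ComplEx-type models with embedding size $k$, entities and relations are embedded as vectors in $\mathbb C^k$, and the probability of a triple (head $h$, relation $r$, tail $t$) with embeddings $\mathbf h,\mathbf r,\mathbf t$ is $\mu(\mathbf h,\mathbf r,\mathbf t)=\sigma(\mathrm{Re}\,\langle \mathbf h,\mathbf r,\overline{\mathbf t}\rangle)$, where $\sigma(x)=1/(1+e^{-x})$ and $\overline{\mathbf t}$ is the element-wise complex conjugate. ComplEx-NNE+AER is the variant in which legal entity embeddings are the vectors in $\mathbb C^k$ whose real and imaginary parts are element-wise non-negative, and in which a subsumption $(h,r,t)\rightarrow(h,s,t)$ (for all entities $h,t$) is imposed through the constraints $\mathrm{Re}(\mathbf r)\le\mathrm{Re}(\mathbf s)$ (element-wise) and $\mathrm{Im}(\mathbf r)=\mathrm{Im}(\mathbf s)$ on the relation embeddings. Embeddings represent a truth assignment $\mathcal W\subseteq\mathcal E\times\mathcal R\times\mathcal E$ (the set of true triples; all other triples are false) if $\mu(\mathbf h,\mathbf p,\mathbf t)>1/2$ for every $(h,p,t)\in\mathcal W$ and $\mu(\mathbf h,\mathbf p,\mathbf t)<1/2$ for every $(h,p,t)\in(\mathcal E\times\mathcal R\times\mathcal E)\setminus\mathcal W$. A model is fully expressive if every truth assignment can be represented by some choice of embeddings. *)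

theory Defs
  imports Complex_Main "Jordan_Normal_Form.Matrix"
begin

definition triple_product :: "complex vec \<Rightarrow> complex vec \<Rightarrow> complex vec \<Rightarrow> complex"
  where "triple_product x y z = (\<Sum>l<dim_vec x. x $ l * y $ l * z $ l)"

definition logistic :: "real \<Rightarrow> real"
  where "logistic x = 1 / (1 + exp (- x))"

text \<open>The arguments are, in this order, the embeddings of head, relation and tail;
  all are meant to have the same dimension.\<close>

definition triple_prob :: "complex vec \<Rightarrow> complex vec \<Rightarrow> complex vec \<Rightarrow> real"
  where "triple_prob h r t = logistic (Re (triple_product h r (conjugate t)))"

definition legal_entity_embeddings :: "nat \<Rightarrow> complex vec set"
  where "legal_entity_embeddings k =
    {v \<in> carrier_vec k. \<forall>l<k. 0 \<le> Re (v $ l) \<and> 0 \<le> Im (v $ l)}"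

definition subsumption_constraint :: "complex vec \<Rightarrow> complex vec \<Rightarrow> bool"
  where "subsumption_constraint r s \<longleftrightarrow>
    map_vec Re r \<le> map_vec Re s \<and> map_vec Im r = map_vec Im s"

text \<open>The symmetry constraint ranges over all legal entity embeddings of the given size,
  not only over those assigned to the entities of a particular data set.\<close>

definition symmetry_constraint :: "nat \<Rightarrow> complex vec \<Rightarrow> bool"
  where "symmetry_constraint k r \<longleftrightarrow>
    (\<forall>h\<in>legal_entity_embeddings k. \<forall>t\<in>legal_entity_embeddings k.
      triple_prob h r t = triple_prob t r h)"

definition represents ::
    "('e \<Rightarrow> complex vec) \<Rightarrow> ('r \<Rightarrow> complex vec) \<Rightarrow> 'e set \<Rightarrow> 'r set \<Rightarrow> ('e \<times> 'r \<times> 'e) set \<Rightarrow> bool"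
  where "represents ent rel E R W \<longleftrightarrow>
    (\<forall>(h, p, t)\<in>W. triple_prob (ent h) (rel p) (ent t) > 1 / 2) \<and>
    (\<forall>(h, p, t)\<in>(E \<times> R \<times> E) - W. triple_prob (ent h) (rel p) (ent t) < 1 / 2)"

end

theory Submission
  imports Defs
begin

text \<open>The symmetry constraint forces the embedding of \<open>r\<close> to be real, as testing it on a basis
  vector and \<open>\<i>\<close> times this vector shows. The subsumption constraint transfers
  this to \<open>s\<close>, so that \<open>s\<close> is scored symmetrically as well. Hence no asymmetric truth
  assignment for \<open>s\<close> can be represented, for instance one with a single true triple.\<close>

lemma logistic_inject: "logistic x = logistic y \<longleftrightarrow> x = y"
proof
  assume "logistic x = logistic y"
  moreover have "1 + exp (- x) > 0" "1 + exp (- y) > 0"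
    by (simp_all add: add_pos_pos)
  ultimately show "x = y"
    by (simp add: logistic_def field_simps)
qed simp

text \<open>Only the summand at \<open>l\<close> survives, so scaled unit vectors read off a single
  coordinate of \<open>r\<close>. The scalars \<open>a\<close> and \<open>b\<close> set its
  phase.\<close>

lemma triple_product_unit_vec:
  assumes "l < k" "r \<in> carrier_vec k"
  shows "triple_product (a \<cdot>\<^sub>v unit_vec k l) r (conjugate (b \<cdot>\<^sub>v unit_vec k l)) = a * r $ l * cnj b"
proof -
  have "triple_product (a \<cdot>\<^sub>v unit_vec k l) r (conjugate (b \<cdot>\<^sub>v unit_vec k l)) =
      (\<Sum>j<k. if j = l then a * r $ l * cnj b else 0)"
    unfolding triple_product_def using assms
    by (intro sum.cong) (auto simp: unit_vec_def)
  also have "\<dots> = a * r $ l * cnj b"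
    using assms(1) by simp
  finally show ?thesis .
qed

lemma symmetry_constraint_imp_real:
  assumes sym: "symmetry_constraint k r" and r: "r \<in> carrier_vec k" and l: "l < k"
  shows "Im (r $ l) = 0"
proof -
  \<comment> \<open>Both vectors are legal: their only nonzero entries, 1 and \<open>\<i>\<close>,
    have non-negative real and imaginary parts.\<close>
  let ?h = "1 \<cdot>\<^sub>v unit_vec k l :: complex vec" and ?t = "\<i> \<cdot>\<^sub>v unit_vec k l :: complex vec"
  have "?h \<in> legal_entity_embeddings k" "?t \<in> legal_entity_embeddings k"
    by (auto simp: legal_entity_embeddings_def unit_vec_def)
  with sym have "triple_prob ?h r ?t = triple_prob ?t r ?h"
    unfolding symmetry_constraint_def by blast
  then have "Re (triple_product ?h r (conjugate ?t)) = Re (triple_product ?t r (conjugate ?h))"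
    unfolding triple_prob_def by (simp only: logistic_inject)
  \<comment> \<open>The two sides are Re(-\<open>\<i>\<close> * \<open>r $ l\<close>) =
    Im(\<open>r $ l\<close>) and Re(\<open>\<i>\<close> * \<open>r $ l\<close>) =
    -Im(\<open>r $ l\<close>).\<close>
  then show ?thesis
    by (simp only: triple_product_unit_vec[OF l r]) simp
qed

text \<open>For real \<open>r\<close>, exchanging \<open>h\<close> and \<open>t\<close> conjugates
  every summand, which leaves its real part unchanged.\<close>

lemma triple_prob_commute_if_real:
  assumes "h \<in> carrier_vec k" "r \<in> carrier_vec k" "t \<in> carrier_vec k"
    and "\<And>l. l < k \<Longrightarrow> Im (r $ l) = 0"
  shows "triple_prob h r t = triple_prob t r h"
proof -
  have "Re (triple_product h r (conjugate t)) = Re (triple_product t r (conjugate h))"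
    unfolding triple_product_def Re_sum using assms
    by (intro sum.cong) (auto simp: algebra_simps)
  then show ?thesis
    by (simp add: triple_prob_def)
qed

theorem theorem2:
  "\<exists>(E :: nat set) (R :: nat set) r s (W :: (nat \<times> nat \<times> nat) set).
     finite E \<and> finite R \<and> r \<in> R \<and> s \<in> R \<and> r \<noteq> s \<and> W \<subseteq> E \<times> R \<times> E \<and>
     (\<forall>h\<in>E. \<forall>t\<in>E. (h, r, t) \<in> W \<longrightarrow> (h, s, t) \<in> W) \<and>
     (\<forall>h\<in>E. \<forall>t\<in>E. (h, r, t) \<in> W \<longrightarrow> (t, r, h) \<in> W) \<and>
     (\<forall>k\<ge>1. \<not> (\<exists>(ent :: nat \<Rightarrow> complex vec) (rel :: nat \<Rightarrow> complex vec).
        (\<forall>e\<in>E. ent e \<in> legal_entity_embeddings k) \<and>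
        (\<forall>p\<in>R. rel p \<in> carrier_vec k) \<and>
        subsumption_constraint (rel r) (rel s) \<and>
        symmetry_constraint k (rel r) \<and>
        represents ent rel E R W))"
proof -
  \<comment> \<open>Relation 0 plays \<open>r\<close> and has no true triple, so \<open>?W\<close>
    meets the subsumption and symmetry conditions vacuously. Relation 1 plays \<open>s\<close> and
    holds in one direction only.\<close>
  let ?E = "{0, 1} :: nat set" and ?R = "{0, 1} :: nat set"
    and ?W = "{(0, 1, 1)} :: (nat \<times> nat \<times> nat) set"
  have False
    if ent: "\<forall>e\<in>?E. ent e \<in> legal_entity_embeddings k"
      and rel: "\<forall>p\<in>?R. rel p \<in> carrier_vec k"
      and sub: "subsumption_constraint (rel 0) (rel 1)"
      and sym: "symmetry_constraint k (rel 0)"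
      and rep: "represents ent rel ?E ?R ?W"
    for k and ent rel :: "nat \<Rightarrow> complex vec"
  proof -
    have real: "Im (rel 1 $ l) = 0" if l: "l < k" for l
    proof -
      have "map_vec Im (rel 0) $ l = map_vec Im (rel 1) $ l"
        using sub by (simp add: subsumption_constraint_def)
      then show ?thesis
        using symmetry_constraint_imp_real[OF sym _ l] rel l by auto
    qed
    have "triple_prob (ent 0) (rel 1) (ent 1) = triple_prob (ent 1) (rel 1) (ent 0)"
      by (rule triple_prob_commute_if_real[OF _ _ _ real])
        (use ent rel in \<open>auto simp: legal_entity_embeddings_def\<close>)
    moreover have "triple_prob (ent 0) (rel 1) (ent 1) > 1 / 2"
      using rep by (simp add: represents_def)
    \<comment> \<open>The reversed triple is false, so the same probability would have to lie on
      both sides of 1/2.\<close>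
    moreover have "(1, 1, 0) \<in> ?E \<times> ?R \<times> ?E - ?W"
      by simp
    then have "triple_prob (ent 1) (rel 1) (ent 0) < 1 / 2"
      using rep unfolding represents_def by blast
    ultimately show False
      by simp
  qed
  then show ?thesis
    by (intro exI[of _ ?E] exI[of _ ?R] exI[of _ 0] exI[of _ 1] exI[of _ ?W]) auto
qed

end
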